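(* Let $n\geq 1$ and suppose that $G$ is a group fitting into a short exact sequence $$1\to H\to G\to Q\to 1,$$ where $H$ is finitely generated, $Q$ has rank $n$ (so $Q$ can be generated by $n$ elements), and $\operatorname{rk} H^1(Q;\mathbb{R}) = n$. If $\operatorname{rk} H^1(G;\mathbb{R}) > n$, then $G$ algebraically fibers.
   Context: A group $G$ algebraically fibers if there is a surjective homomorphism $G\to\mathbb{Z}$ with finitely generated kernel. The rank of a group is the minimal number of generators; $\operatorname{rk} H^1(\cdot;\mathbb{R})$ denotes dimension over $\mathbb{R}$. *)

theory Defs
  imports Complex_Main "HOL-Algebra.Algebra" "HOL-Library.Extended_Nat" "HOL-Library.Function_Algebras"
begin

section \<open>Finite generation, rank and algebraic fibering\<close>

definition finitely_generated :: "'a monoid \<Rightarrow> bool" where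
  "finitely_generated G \<longleftrightarrow>
     (\<exists>S. finite S \<and> S \<subseteq> carrier G \<and> generate G S = carrier G)"

text \<open>The infimum of the empty set is \<open>\<infinity>\<close>, the rank of a group that is not
  finitely generated.\<close>

definition group_rank :: "'a monoid \<Rightarrow> enat" where
  "group_rank G =
     (INF S \<in> {S. finite S \<and> S \<subseteq> carrier G \<and> generate G S = carrier G}. enat (card S))"

definition algebraically_fibers :: "'a monoid \<Rightarrow> bool" where
  "algebraically_fibers G \<longleftrightarrow>
     (\<exists>\<phi> \<in> epi G integer_group.
        finitely_generated (G\<lparr>carrier := kernel G integer_group \<phi>\<rparr>))"

text \<open>A short exact sequence \<open>1 \<rightarrow> H \<rightarrow> G \<rightarrow> Q \<rightarrow> 1\<close>. The library predicate
  \<open>short_exact_sequence\<close> forces all groups to live on one type.\<close>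

definition group_extension ::
    "'h monoid \<Rightarrow> ('h \<Rightarrow> 'g) \<Rightarrow> 'g monoid \<Rightarrow> ('g \<Rightarrow> 'q) \<Rightarrow> 'q monoid \<Rightarrow> bool" where
  "group_extension H \<iota> G \<pi> Q \<longleftrightarrow>
     group H \<and> group G \<and> group Q \<and> \<iota> \<in> mon H G \<and> \<pi> \<in> epi G Q \<and>
     \<iota> ` carrier H = kernel G Q \<pi>"

section \<open>First group cohomology with real coefficients\<close>

interpretation fun_space: vector_space "\<lambda>(c::real) (f :: 'a \<Rightarrow> real) x. c * f x"
  by unfold_locales (auto simp: fun_eq_iff algebra_simps)

text \<open>The inhomogeneous cochain complex of \<open>G\<close> with coefficients in \<open>\<real>\<close>, on which
  \<open>G\<close> acts through \<open>\<rho>\<close>. A cochain is a function on \<open>carrier G\<close>; it is represented by its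
  extension by 0, so that cochains with equal values on \<open>carrier G\<close> are equal.\<close>

definition cocycles1 :: "'a monoid \<Rightarrow> ('a \<Rightarrow> real \<Rightarrow> real) \<Rightarrow> ('a \<Rightarrow> real) set" where
  "cocycles1 G \<rho> =
     {f. (\<forall>g. g \<notin> carrier G \<longrightarrow> f g = 0) \<and>
         (\<forall>g \<in> carrier G. \<forall>h \<in> carrier G. \<rho> g (f h) - f (g \<otimes>\<^bsub>G\<^esub> h) + f g = 0)}"

definition coboundaries1 :: "'a monoid \<Rightarrow> ('a \<Rightarrow> real \<Rightarrow> real) \<Rightarrow> ('a \<Rightarrow> real) set" where
  "coboundaries1 G \<rho> = range (\<lambda>r g. if g \<in> carrier G then \<rho> g r - r else 0)"

text \<open>The dimension of \<open>V / W\<close> for subspaces \<open>W \<subseteq> V\<close>: the least number of elements of \<open>V\<close>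
  whose classes span \<open>V / W\<close>, and \<open>\<infinity>\<close> if no finite set does.\<close>

definition quotient_dim :: "('a \<Rightarrow> real) set \<Rightarrow> ('a \<Rightarrow> real) set \<Rightarrow> enat" where
  "quotient_dim V W =
     (INF S \<in> {S. finite S \<and> S \<subseteq> V \<and> V \<subseteq> fun_space.span (S \<union> W)}. enat (card S))"

definition rk_H1 :: "'a monoid \<Rightarrow> enat" where
  "rk_H1 G = quotient_dim (cocycles1 G (\<lambda>_ r. r)) (coboundaries1 G (\<lambda>_ r. r))"

text \<open>Consistency check: the rank is the cardinality of any finite basis of the space
  \<open>Hom(G, \<real>)\<close>.\<close>

lemma cocycles1_trivial_iff:
  "f \<in> cocycles1 G (\<lambda>_ r. r) \<longleftrightarrow>
     (\<forall>g. g \<notin> carrier G \<longrightarrow> f g = 0) \<and>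
     (\<forall>g \<in> carrier G. \<forall>h \<in> carrier G. f (g \<otimes>\<^bsub>G\<^esub> h) = f g + f h)"
  unfolding cocycles1_def by (auto simp: algebra_simps)

lemma coboundaries1_trivial: "coboundaries1 G (\<lambda>_ r. r) = {0}"
  unfolding coboundaries1_def by (auto simp: fun_eq_iff)

lemma rk_H1_eq_card_basis:
  assumes "finite B" "fun_space.independent B"
    and "fun_space.span B = cocycles1 G (\<lambda>_ r. r)"
  shows "rk_H1 G = enat (card B)"
proof (rule antisym)
  have "B \<subseteq> cocycles1 G (\<lambda>_ r. r)"
    using assms(3) fun_space.span_superset by blast
  then show "rk_H1 G \<le> enat (card B)"
    unfolding rk_H1_def quotient_dim_def coboundaries1_trivial
    by (intro INF_lower) (use assms in auto)
next
  show "enat (card B) \<le> rk_H1 G"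
    unfolding rk_H1_def quotient_dim_def coboundaries1_trivial
  proof (rule INF_greatest)
    fix S assume S: "S \<in> {S. finite S \<and> S \<subseteq> cocycles1 G (\<lambda>_ r. r) \<and>
        cocycles1 G (\<lambda>_ r. r) \<subseteq> fun_space.span (S \<union> {0})}"
    then have "B \<subseteq> fun_space.span S"
      using assms(3) fun_space.span_superset[of B] by auto
    then show "enat (card B) \<le> enat (card S)"
      using fun_space.independent_span_bound[of S B] assms S by auto
  qed
qed

end

theory Submission
  imports Defs
begin

text \<open>
  Identify \<open>H\<close> with the kernel of \<open>\<pi>\<close>, let \<open>q\<^sub>1, \<dots>, q\<^sub>n\<close> generate \<open>Q\<close>, and choose lifts
  \<open>t\<^sub>1, \<dots>, t\<^sub>n\<close> in \<open>G\<close>. A homomorphism \<open>Q \<rightarrow> \<real>\<close> is determined by its values on the \<open>q\<^sub>i\<close>, and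
  since the space of these homomorphisms has the full dimension \<open>n\<close>, all values occur
  (\<open>exists_cocycle1_with_values\<close>). This gives two homomorphisms from \<open>G\<close> to \<open>\<int>\<close>.

  \<^item> The first, \<open>\<chi>\<close>, vanishes on the \<open>t\<^sub>i\<close> and takes the value 1 at some \<open>s \<in> H\<close>. If all homomorphisms
    \<open>G \<rightarrow> \<real>\<close> vanished on \<open>H\<close>, they would factor through \<open>Q\<close> and form a space of dimension
    at most \<open>n\<close>; so one of them does not (\<open>exists_cocycle1_nonzero_on_kernel\<close>). Subtracting a
    homomorphism pulled back from \<open>Q\<close> makes it vanish on the \<open>t\<^sub>i\<close>; a \<open>\<rat>\<close>-linear functional on \<open>\<real>\<close>,
    followed by clearing denominators and dividing by a greatest common divisor, makes it
    integral (\<open>integral_cocycle1\<close>, \<open>normalise_integer_hom\<close>).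

  \<^item> The second, \<open>e\<close>, is pulled back from \<open>Q\<close> and has \<open>e t\<^sub>1 = 1\<close>; it vanishes on \<open>H\<close>.

  The homomorphism \<open>\<phi> = \<chi> + m e\<close> is surjective, and its kernel is finitely generated once \<open>m\<close> is
  large. Indeed the kernel maps onto \<open>Q\<close> because \<open>\<phi>(H) = \<int>\<close>, so it is generated by the elements
  \<open>s\<^bsup>-\<phi>(t\<^sub>i)\<^esup> t\<^sub>i\<close> and by \<open>N\<close>, the kernel of \<open>\<chi>\<close> on \<open>H\<close>. The group \<open>N\<close> may not be finitely
  generated, but it is the increasing union of finitely generated slabs \<open>N\<^sub>r\<close>, generated by the
  conjugates \<open>s\<^sup>k x s\<^bsup>-k\<^esup>\<close> with \<open>\<bar>k\<bar> \<le> r\<close> and \<open>x\<close> from a fixed finite set. Conjugation by \<open>t\<^sub>1\<close> or its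
  inverse raises \<open>r\<close> by at most a constant \<open>c\<close> (\<open>conjugate_slab_growth\<close>), while conjugation by
  \<open>s\<^bsup>-m\<^esup>\<close> moves the generators near one end of a slab inwards by \<open>m\<close>. For \<open>m > c\<close> the elements
  \<open>t\<^sub>1 s\<^bsup>-m\<^esup>\<close> and \<open>t\<^sub>1\<^bsup>-1\<^esup> s\<^bsup>m\<^esup>\<close> of the kernel of \<open>\<phi>\<close> therefore conjugate \<open>s\<^bsup>r+1\<^esup> x s\<^bsup>-r-1\<^esup>\<close>
  and \<open>s\<^bsup>-r-1\<^esup> x s\<^bsup>r+1\<^esup>\<close> into \<open>N\<^sub>r\<close> for all \<open>r \<ge> m\<close>. By induction, these two elements and \<open>N\<^sub>m\<close> generate a group
  that contains \<open>N\<close> (\<open>slab_subset_if_conjugators\<close>).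
\<close>

section \<open>Conjugation\<close>

lemma group_hom_integerI: "group G \<Longrightarrow> \<psi> \<in> hom G integer_group \<Longrightarrow> group_hom G integer_group \<psi>"
  by (simp add: group_hom_def group_hom_axioms_def)

context group
begin

lemma inv_mult_cancel [simp]:
  assumes "x \<in> carrier G" "y \<in> carrier G"
  shows "inv x \<otimes> (x \<otimes> y) = y" "x \<otimes> (inv x \<otimes> y) = y"
  using assms by (simp_all flip: m_assoc)

definition conjugate :: "'a \<Rightarrow> 'a \<Rightarrow> 'a" where
  "conjugate g x = g \<otimes> x \<otimes> inv g"

lemma conjugate_closed [simp]:
  "g \<in> carrier G \<Longrightarrow> x \<in> carrier G \<Longrightarrow> conjugate g x \<in> carrier G"
  by (simp add: conjugate_def)

lemma conjugate_conjugate: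
  "g \<in> carrier G \<Longrightarrow> h \<in> carrier G \<Longrightarrow> x \<in> carrier G \<Longrightarrow>
    conjugate g (conjugate h x) = conjugate (g \<otimes> h) x"
  by (simp add: conjugate_def inv_mult_group m_assoc)

lemma conjugate_one [simp]: "x \<in> carrier G \<Longrightarrow> conjugate \<one> x = x"
  by (simp add: conjugate_def)

lemma conjugate_one_right [simp]: "g \<in> carrier G \<Longrightarrow> conjugate g \<one> = \<one>"
  by (simp add: conjugate_def)

lemma conjugate_mult:
  assumes "g \<in> carrier G" "x \<in> carrier G" "y \<in> carrier G"
  shows "conjugate g (x \<otimes> y) = conjugate g x \<otimes> conjugate g y"
  using assms by (simp add: conjugate_def m_assoc)

lemma conjugate_inv:
  assumes "g \<in> carrier G" "x \<in> carrier G"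
  shows "conjugate g (inv x) = inv (conjugate g x)"
  using assms by (simp add: conjugate_def m_assoc inv_mult_group)

lemma conjugate_distrib:
  assumes "g \<in> carrier G" "h \<in> carrier G" "x \<in> carrier G"
  shows "conjugate g (conjugate h x) = conjugate (conjugate g h) (conjugate g x)"
  using assms by (simp add: conjugate_conjugate) (simp add: conjugate_def m_assoc inv_mult_group)

lemma conjugate_mem_subgroup_iff:
  assumes "subgroup L G" "v \<in> L" "x \<in> carrier G"
  shows "conjugate v x \<in> L \<longleftrightarrow> x \<in> L"
proof
  have v: "v \<in> carrier G" using assms(1,2) by (rule subgroup.mem_carrier)
  assume "conjugate v x \<in> L"
  then have "inv v \<otimes> conjugate v x \<otimes> v \<in> L"
    using assms(1,2) by (simp add: subgroup.m_closed subgroup.m_inv_closed)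
  moreover have "inv v \<otimes> conjugate v x \<otimes> v = x"
    using v assms(3) by (simp add: conjugate_def m_assoc)
  ultimately show "x \<in> L" by simp
next
  assume "x \<in> L"
  then show "conjugate v x \<in> L"
    using assms(1,2) by (simp add: conjugate_def subgroup.m_closed subgroup.m_inv_closed)
qed

lemma conjugate_generate_subset:
  assumes "A \<subseteq> carrier G" "B \<subseteq> carrier G" "g \<in> carrier G"
    and "\<And>x. x \<in> A \<Longrightarrow> conjugate g x \<in> generate G B"
    and "y \<in> generate G A"
  shows "conjugate g y \<in> generate G B"
  using assms(5)
proof induction
  case one
  then show ?case using assms(3) generate.one by simp
next
  case (incl h)
  then show ?case by (rule assms(4))
next
  case (inv h)
  then show ?case
    using assms(1-4) generate_m_inv_closed[OF assms(2)] by (auto simp: conjugate_inv)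
next
  case (eng h1 h2)
  then show ?case
    using assms(1,3) generate_in_carrier[OF assms(1)] by (simp add: conjugate_mult generate.eng)
qed

section \<open>Slabs\<close>

definition slab_gens :: "'a \<Rightarrow> 'a set \<Rightarrow> int \<Rightarrow> 'a set" where
  "slab_gens s E r = {conjugate (s [^] k) x | k x. \<bar>k\<bar> \<le> r \<and> x \<in> E}"

abbreviation slab :: "'a \<Rightarrow> 'a set \<Rightarrow> int \<Rightarrow> 'a set" where
  "slab s E r \<equiv> generate G (slab_gens s E r)"

lemma finite_slab_gens:
  assumes "finite E"
  shows "finite (slab_gens s E r)"
proof -
  have "slab_gens s E r = (\<lambda>(k, x). conjugate (s [^] k) x) ` ({-r..r} \<times> E)"
    unfolding slab_gens_def by (force simp: abs_le_iff)
  then show ?thesis using assms by simp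
qed

lemma slab_gens_subset_carrier:
  "s \<in> carrier G \<Longrightarrow> E \<subseteq> carrier G \<Longrightarrow> slab_gens s E r \<subseteq> carrier G"
  unfolding slab_gens_def by auto

lemma slab_mono: "r \<le> r' \<Longrightarrow> slab s E r \<subseteq> slab s E r'"
  by (rule mono_generate) (force simp: slab_gens_def)

lemma subgroup_slab: "s \<in> carrier G \<Longrightarrow> E \<subseteq> carrier G \<Longrightarrow> subgroup (slab s E r) G"
  by (simp add: generate_is_subgroup slab_gens_subset_carrier)

lemma conjugate_pow_slab:
  assumes "s \<in> carrier G" "E \<subseteq> carrier G" "y \<in> slab s E r"
  shows "conjugate (s [^] (j :: int)) y \<in> slab s E (r + \<bar>j\<bar>)"
proof (rule conjugate_generate_subset[OF _ _ _ _ assms(3)])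
  fix x assume "x \<in> slab_gens s E r"
  then obtain k x0 where x: "x = conjugate (s [^] k) x0" "\<bar>k\<bar> \<le> r" "x0 \<in> E"
    unfolding slab_gens_def by blast
  have "conjugate (s [^] j) x = conjugate (s [^] (j + k)) x0"
    using assms(1,2) x by (auto simp: conjugate_conjugate int_pow_mult)
  moreover have "\<bar>j + k\<bar> \<le> r + \<bar>j\<bar>" using x(2) by linarith
  ultimately show "conjugate (s [^] j) x \<in> slab s E (r + \<bar>j\<bar>)"
    using x(3) by (auto intro!: generate.incl simp: slab_gens_def)
qed (use assms in \<open>auto simp: slab_gens_subset_carrier\<close>)

text \<open>A Schreier argument with the powers of \<open>s\<close> as coset representatives. For \<open>h\<close> in the kernel of \<open>\<chi>\<close>
  the power of \<open>s\<close> is trivial and \<open>h\<close> itself lies in a slab. Carrying the factor \<open>s\<^bsup>\<chi> h\<^esup>\<close> along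
  makes the claim compatible with products, because moving a power of \<open>s\<close> past an element of a
  slab only enlarges the slab.\<close>

lemma mem_slab_if_generated:
  assumes S: "S \<subseteq> carrier G" and s: "s \<in> carrier G"
    and \<chi>: "\<chi> \<in> hom G integer_group"
    and h: "h \<in> generate G S"
  shows "\<exists>r\<ge>0. h \<otimes> inv (s [^] \<chi> h) \<in> slab s ((\<lambda>a. a \<otimes> inv (s [^] \<chi> a)) ` S) r"
    (is "\<exists>r\<ge>0. _ \<in> slab s ?E r")
  using h
proof induction
  interpret \<chi>: group_hom G integer_group \<chi>
    using \<chi> by (simp add: group_hom_def group_hom_axioms_def)
  have E: "?E \<subseteq> carrier G" using S s by auto
  {
    case one
    have "\<chi> \<one> = 0" using \<chi>.hom_one by simp
    then show ?case using s by (auto intro: generate.one)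
  next
    case (incl a)
    then have "a \<otimes> inv (s [^] \<chi> a) \<in> slab_gens s ?E 0"
      unfolding slab_gens_def using S s by (auto intro!: exI[of _ 0] exI[of _ "a \<otimes> inv (s [^] \<chi> a)"])
    then have "a \<otimes> inv (s [^] \<chi> a) \<in> slab s ?E 0" by (rule generate.incl)
    then show ?case by (intro exI[of _ 0] conjI) simp_all
  next
    case (inv a)
    then have a: "a \<in> carrier G" using S by auto
    define x where "x = a \<otimes> inv (s [^] \<chi> a)"
    have x: "x \<in> ?E" "x \<in> carrier G" using inv a s by (auto simp: x_def)
    have "x \<in> slab_gens s ?E 0"
      unfolding slab_gens_def using x by (auto intro!: exI[of _ 0] exI[of _ x])
    then have "inv x \<in> slab s ?E 0" by (rule generate.inv)
    then have "conjugate (s [^] (- \<chi> a)) (inv x) \<in> slab s ?E (0 + \<bar>- \<chi> a\<bar>)"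
      by (rule conjugate_pow_slab[OF s E])
    moreover have "\<chi> (inv a) = - \<chi> a" using \<chi>.hom_inv a by simp
    moreover have "conjugate (s [^] (- \<chi> a)) (inv x) = inv a \<otimes> inv (s [^] (- \<chi> a))"
      using a s by (simp add: x_def conjugate_def inv_mult_group int_pow_neg m_assoc)
    ultimately show ?case by (intro exI[of _ "\<bar>- \<chi> a\<bar>"]) simp
  next
    case (eng a b)
    have ab: "a \<in> carrier G" "b \<in> carrier G"
      using eng.hyps generate_in_carrier[OF S] by auto
    obtain p where p: "p \<ge> 0" "a \<otimes> inv (s [^] \<chi> a) \<in> slab s ?E p" using eng.IH by blast
    obtain q where q: "q \<ge> 0" "b \<otimes> inv (s [^] \<chi> b) \<in> slab s ?E q" using eng.IH by blast
    define r where "r = p + q + \<bar>\<chi> a\<bar>"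
    have 1: "a \<otimes> inv (s [^] \<chi> a) \<in> slab s ?E r"
      using p q slab_mono[of p r s ?E] by (auto simp: r_def)
    have "conjugate (s [^] \<chi> a) (b \<otimes> inv (s [^] \<chi> b)) \<in> slab s ?E (q + \<bar>\<chi> a\<bar>)"
      by (rule conjugate_pow_slab[OF s E q(2)])
    then have 2: "conjugate (s [^] \<chi> a) (b \<otimes> inv (s [^] \<chi> b)) \<in> slab s ?E r"
      using p slab_mono[of "q + \<bar>\<chi> a\<bar>" r s ?E] by (auto simp: r_def)
    have "\<chi> (a \<otimes> b) = \<chi> a + \<chi> b" using \<chi>.hom_mult ab by simp
    then have "a \<otimes> b \<otimes> inv (s [^] \<chi> (a \<otimes> b)) =
        (a \<otimes> inv (s [^] \<chi> a)) \<otimes> conjugate (s [^] \<chi> a) (b \<otimes> inv (s [^] \<chi> b))"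
      using ab s by (simp add: conjugate_def int_pow_mult inv_mult_group m_assoc)
    with generate.eng[OF 1 2] show ?case
      using p q by (intro exI[of _ r]) (simp add: r_def)
  }
qed

lemma uniform_slab_bound:
  assumes "finite A" "\<And>a. a \<in> A \<Longrightarrow> \<exists>r\<ge>0. a \<in> slab s E r"
  shows "\<exists>c\<ge>0. A \<subseteq> slab s E c"
  using assms
proof (induction A)
  case empty
  then show ?case by auto
next
  case (insert a A)
  then obtain c where c: "c \<ge> 0" "A \<subseteq> slab s E c" by auto
  obtain r where r: "r \<ge> 0" "a \<in> slab s E r" using insert.prems by blast
  have "slab s E c \<subseteq> slab s E (max c r)" "slab s E r \<subseteq> slab s E (max c r)"
    by (auto intro!: slab_mono)
  with c r show ?case by (intro exI[of _ "max c r"]) auto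
qed

text \<open>If \<open>y = (t s t\<^bsup>-1\<^esup>) s\<^bsup>-1\<^esup>\<close>, then conjugation by \<open>t\<close> turns conjugation by \<open>s\<close> into
  conjugation by \<open>y s\<close>. The factor \<open>s\<close> enlarges a slab by one and the factor \<open>y\<close>, lying in a slab
  already, not at all. So one more power of \<open>s\<close> costs only one more step, and the excess \<open>c\<close>
  does not depend on \<open>k\<close>.\<close>

lemma conjugate_slab_growth:
  assumes s: "s \<in> carrier G" and E: "E \<subseteq> carrier G" and t: "t \<in> carrier G" and c: "c \<ge> 0"
    and cE: "\<And>x. x \<in> E \<Longrightarrow> conjugate t x \<in> slab s E c"
    and cs: "conjugate t s \<otimes> inv s \<in> slab s E c"
    and x: "x \<in> E"
  shows "conjugate t (conjugate (s [^] (k :: int)) x) \<in> slab s E (\<bar>k\<bar> + c)"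
proof (induction k rule: int_induct[of _ 0])
  case base
  have "x \<in> carrier G" using E x by auto
  then show ?case using cE[OF x] by simp
next
  define y where "y = conjugate t s \<otimes> inv s"
  have xc: "x \<in> carrier G" using E x by auto
  have y: "y \<in> carrier G" and ts: "conjugate t s = y \<otimes> s"
    using s t by (auto simp: y_def m_assoc)
  {
    case (step1 k)
    let ?z = "conjugate t (conjugate (s [^] k) x)"
    have "conjugate (s [^] (1 :: int)) ?z \<in> slab s E (\<bar>k\<bar> + c + \<bar>1\<bar>)"
      by (rule conjugate_pow_slab[OF s E step1(2)])
    then have z: "conjugate s ?z \<in> slab s E (\<bar>k + 1\<bar> + c)"
      using s step1(1) by (simp add: int_pow_1 add.commute add.left_commute)
    have "y \<in> slab s E (\<bar>k + 1\<bar> + c)"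
      using cs slab_mono[of c "\<bar>k + 1\<bar> + c" s E] by (auto simp: y_def)
    then have "conjugate y (conjugate s ?z) \<in> slab s E (\<bar>k + 1\<bar> + c)"
      using conjugate_mem_subgroup_iff[OF subgroup_slab[OF s E]] z s t xc by simp
    moreover have "conjugate t (conjugate (s [^] (k + 1)) x) = conjugate y (conjugate s ?z)"
    proof -
      have "s [^] (k + 1) = s \<otimes> s [^] k"
        using s int_pow_mult[of s 1 k] by (simp add: int_pow_1 add.commute)
      then have "conjugate t (conjugate (s [^] (k + 1)) x) = conjugate t (conjugate s (conjugate (s [^] k) x))"
        using s xc by (simp add: conjugate_conjugate)
      also have "\<dots> = conjugate (conjugate t s) ?z"
        using s t xc by (simp add: conjugate_distrib[of t s])
      finally show ?thesis
        using s t xc y by (simp add: ts conjugate_conjugate[of y s])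
    qed
    ultimately show ?case by simp
  next
    case (step2 k)
    let ?z = "conjugate t (conjugate (s [^] k) x)"
    have "inv y \<in> slab s E (\<bar>k\<bar> + c)"
      using cs slab_mono[of c "\<bar>k\<bar> + c" s E] subgroup.m_inv_closed[OF subgroup_slab[OF s E]]
      by (auto simp: y_def)
    then have "conjugate (inv y) ?z \<in> slab s E (\<bar>k\<bar> + c)"
      using conjugate_mem_subgroup_iff[OF subgroup_slab[OF s E]] step2(2) s t xc by simp
    then have "conjugate (s [^] (-1 :: int)) (conjugate (inv y) ?z) \<in> slab s E (\<bar>k\<bar> + c + \<bar>-1\<bar>)"
      by (rule conjugate_pow_slab[OF s E])
    then have "conjugate (inv s) (conjugate (inv y) ?z) \<in> slab s E (\<bar>k - 1\<bar> + c)"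
      using s step2(1) by (simp add: int_pow_neg int_pow_1 algebra_simps)
    moreover have "conjugate t (conjugate (s [^] (k - 1)) x) = conjugate (inv s) (conjugate (inv y) ?z)"
    proof -
      have "s [^] (k - 1) = inv s \<otimes> s [^] k"
        using s int_pow_mult[of s "-1" k] by (simp add: int_pow_1 int_pow_neg)
      then have "conjugate t (conjugate (s [^] (k - 1)) x) = conjugate t (conjugate (inv s) (conjugate (s [^] k) x))"
        using s xc by (simp add: conjugate_conjugate)
      also have "\<dots> = conjugate (inv (conjugate t s)) ?z"
        using s t xc by (simp add: conjugate_distrib[of t "inv s"] conjugate_inv)
      finally show ?thesis
        using s t xc y by (simp add: ts inv_mult_group conjugate_conjugate[of "inv s" "inv y"])
    qed
    ultimately show ?case by simp
  }
qed

text \<open>Induction on the radius \<open>b \<ge> m\<close> of a slab contained in \<open>L\<close>. The new generators have exponent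
  \<open>\<plusminus>(b + 1)\<close>. Conjugation by \<open>t s\<^bsup>-m\<^esup>\<close> first lowers the exponent \<open>b + 1\<close> to \<open>b + 1 - m \<ge> 0\<close> and then
  adds at most \<open>c < m\<close> to the radius, so it ends inside radius \<open>b\<close>; at the other end
  \<open>t\<^bsup>-1\<^esup> s\<^bsup>m\<^esup>\<close> does the same.\<close>

lemma slab_subset_if_conjugators:
  assumes s: "s \<in> carrier G" and E: "E \<subseteq> carrier G" and t: "t \<in> carrier G"
    and L: "subgroup L G" and m: "0 \<le> c" "c < m"
    and cE: "\<And>k x. x \<in> E \<Longrightarrow> conjugate t (conjugate (s [^] (k :: int)) x) \<in> slab s E (\<bar>k\<bar> + c)"
    and cE': "\<And>k x. x \<in> E \<Longrightarrow> conjugate (inv t) (conjugate (s [^] (k :: int)) x) \<in> slab s E (\<bar>k\<bar> + c)"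
    and L0: "slab_gens s E m \<subseteq> L"
    and u: "t \<otimes> s [^] (- m) \<in> L" and u': "inv t \<otimes> s [^] m \<in> L"
  shows "slab s E r \<subseteq> L"
proof -
  have "slab s E (m + int j) \<subseteq> L" for j
  proof (induction j)
    case 0
    then show ?case using generate_subgroup_incl[OF L0 L] by simp
  next
    case (Suc j)
    define b where "b = m + int j"
    have b: "slab s E b \<subseteq> L" using Suc by (simp add: b_def)
    have "slab_gens s E (b + 1) \<subseteq> L"
    proof
      fix z assume "z \<in> slab_gens s E (b + 1)"
      then obtain k x where z: "z = conjugate (s [^] k) x" and k: "\<bar>k\<bar> \<le> b + 1" and x: "x \<in> E"
        unfolding slab_gens_def by blast
      have xc: "x \<in> carrier G" using x E by auto
      have zc: "z \<in> carrier G" using z s xc by simp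
      consider "\<bar>k\<bar> \<le> b" | "k = b + 1" | "k = - (b + 1)" using k by linarith
      then show "z \<in> L"
      proof cases
        case 1
        then have "z \<in> slab_gens s E b" using z x by (auto simp: slab_gens_def)
        then have "z \<in> slab s E b" by (rule generate.incl)
        then show ?thesis using b by blast
      next
        case 2
        have "conjugate (t \<otimes> s [^] (- m)) z = conjugate t (conjugate (s [^] (k - m)) x)"
        proof -
          have "s [^] (k - m) = s [^] (- m) \<otimes> s [^] k"
            using int_pow_mult[OF s, of "- m" k] by simp
          then show ?thesis using s t xc unfolding z by (simp add: conjugate_conjugate m_assoc)
        qed
        moreover have "\<bar>k - m\<bar> + c \<le> b" using 2 m by (simp add: b_def)
        ultimately have "conjugate (t \<otimes> s [^] (- m)) z \<in> slab s E b"
          using cE[OF x, of "k - m"] slab_mono[of "\<bar>k - m\<bar> + c" b s E] by auto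
        then show ?thesis using b conjugate_mem_subgroup_iff[OF L u zc] by blast
      next
        case 3
        have "conjugate (inv t \<otimes> s [^] m) z = conjugate (inv t) (conjugate (s [^] (k + m)) x)"
        proof -
          have "s [^] (k + m) = s [^] m \<otimes> s [^] k"
            using int_pow_mult[OF s, of m k] by (simp add: add.commute)
          then show ?thesis using s t xc unfolding z by (simp add: conjugate_conjugate m_assoc)
        qed
        moreover have "\<bar>k + m\<bar> + c \<le> b" using 3 m by (simp add: b_def)
        ultimately have "conjugate (inv t \<otimes> s [^] m) z \<in> slab s E b"
          using cE'[OF x, of "k + m"] slab_mono[of "\<bar>k + m\<bar> + c" b s E] by auto
        then show ?thesis using b conjugate_mem_subgroup_iff[OF L u' zc] by blast
      qed
    qed
    then have "slab s E (b + 1) \<subseteq> L" by (rule generate_subgroup_incl[OF _ L])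
    then show ?case by (simp add: b_def algebra_simps)
  qed
  then have "slab s E (m + int (nat (r - m))) \<subseteq> L" .
  moreover have "slab s E r \<subseteq> slab s E (m + int (nat (r - m)))" by (rule slab_mono) simp
  ultimately show ?thesis by blast
qed

end

section \<open>A finitely generated kernel\<close>

lemma (in group) integer_hom_eq_zero_if_generated:
  assumes "e \<in> hom G integer_group" "S \<subseteq> carrier G" "\<And>a. a \<in> S \<Longrightarrow> e a = 0" "h \<in> generate G S"
  shows "e h = 0"
proof -
  interpret e: group_hom G integer_group e using is_group assms(1) by (rule group_hom_integerI)
  have "S \<subseteq> kernel G integer_group e" using assms(2,3) by (auto simp: kernel_def)
  then have "generate G S \<subseteq> kernel G integer_group e"
    by (rule generate_subgroup_incl[OF _ e.subgroup_kernel])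
  then show ?thesis using assms(4) by (auto simp: kernel_def)
qed

lemma (in group) integer_hom_conjugate:
  assumes "e \<in> hom G integer_group" "g \<in> carrier G" "x \<in> carrier G"
  shows "e (conjugate g x) = e x"
proof -
  interpret e: group_hom G integer_group e using is_group assms(1) by (rule group_hom_integerI)
  show ?thesis
    using assms(2,3) e.hom_mult e.hom_inv by (simp add: conjugate_def)
qed

text \<open>The group-theoretic core: \<open>\<chi>\<close> maps the normal subgroup generated by \<open>S\<close> onto \<open>\<int>\<close>, and \<open>e\<close> vanishes on
  that subgroup but not on \<open>t\<close>. Adding a large multiple of \<open>e\<close> to \<open>\<chi>\<close> leaves the values on the
  normal subgroup unchanged and makes conjugation by elements of the kernel strong enough to
  absorb all slabs.\<close>

lemma algebraically_fibers_if_excess: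
  fixes G :: "'a monoid" (structure)
  assumes G: "group G" and S: "finite S" "S \<subseteq> carrier G" and T: "finite T" "T \<subseteq> carrier G"
    and ST: "generate G (S \<union> T) = carrier G" and normal: "generate G S \<lhd> G"
    and \<chi>: "\<chi> \<in> hom G integer_group" "\<And>a. a \<in> T \<Longrightarrow> \<chi> a = 0"
    and s: "s \<in> generate G S" "\<chi> s = 1"
    and e: "e \<in> hom G integer_group" "\<And>a. a \<in> S \<Longrightarrow> e a = 0"
    and t: "t \<in> T" "e t = 1"
  shows "algebraically_fibers G"
proof -
  interpret group G by (rule G)
  define H where "H = generate G S"
  have H: "subgroup H G" unfolding H_def by (rule generate_is_subgroup[OF S(2)])
  have conj_H: "conjugate g h \<in> H" if "g \<in> carrier G" "h \<in> H" for g h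
    using normal.inv_op_closed2[OF normal] that by (simp add: H_def conjugate_def)
  have Hc: "h \<in> carrier G" if "h \<in> H" for h using that by (rule subgroup.mem_carrier[OF H])
  have sc: "s \<in> carrier G" and tc: "t \<in> carrier G" using Hc s(1) t(1) T(2) by (auto simp: H_def)
  have e_H: "e h = 0" if "h \<in> H" for h
    using integer_hom_eq_zero_if_generated[OF e(1) S(2) e(2)] that by (simp add: H_def)
  interpret \<chi>: group_hom G integer_group \<chi> using is_group \<chi>(1) by (rule group_hom_integerI)
  interpret e: group_hom G integer_group e using is_group e(1) by (rule group_hom_integerI)
  define X1 where "X1 = (\<lambda>a. a \<otimes> inv (s [^] \<chi> a)) ` S"
  have S_H: "a \<in> H" if "a \<in> S" for a using generate.incl[OF that] by (simp add: H_def)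
  have s_H: "s \<in> H" using s by (simp add: H_def)
  have \<chi>_pow: "\<chi> (s [^] j) = j" for j :: int using \<chi>.hom_int_pow[OF sc] s(2) by simp
  have e_pow: "e (s [^] j) = 0" for j :: int using e.hom_int_pow[OF sc] e_H[OF s_H] by simp
  have X1_H: "x \<in> H \<and> \<chi> x = 0" if "x \<in> X1" for x
  proof -
    from that obtain a where a: "a \<in> S" "x = a \<otimes> inv (s [^] \<chi> a)" by (auto simp: X1_def)
    have "x \<in> H" unfolding a(2)
      by (intro subgroup.m_closed[OF H] subgroup.m_inv_closed[OF H] subgroup_int_pow_closed[OF H] S_H a s_H)
    moreover have "\<chi> x = 0"
      using a S(2) sc \<chi>.hom_mult[of a "inv (s [^] \<chi> a)"] \<chi>.hom_inv[of "s [^] \<chi> a"] \<chi>_pow by auto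
    ultimately show ?thesis by simp
  qed
  have X1_fin: "finite X1" using S(1) by (simp add: X1_def)
  have X1_c: "X1 \<subseteq> carrier G" using X1_H Hc by blast
  have in_slab: "\<exists>r\<ge>0. h \<in> slab s X1 r" if "h \<in> H" "\<chi> h = 0" for h
    using mem_slab_if_generated[OF S(2) sc \<chi>(1), of h] that Hc[OF that(1)] by (simp add: H_def X1_def)
  \<comment> \<open>The elements on which the growth constant \<open>c\<close> for conjugation by \<open>g\<close> depends.\<close>
  define D where "D g = insert (conjugate g s \<otimes> inv s) (conjugate g ` X1)" for g
  have D_slab: "\<exists>r\<ge>0. h \<in> slab s X1 r" if "h \<in> D g" "g \<in> carrier G" for h g
  proof (rule in_slab)
    show "h \<in> H"
      using that X1_H conj_H s_H subgroup.m_closed[OF H] subgroup.m_inv_closed[OF H] by (auto simp: D_def)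
    show "\<chi> h = 0"
      using that X1_H Hc sc integer_hom_conjugate[OF \<chi>(1)] \<chi>.hom_mult \<chi>.hom_inv by (auto simp: D_def)
  qed
  have "\<exists>c\<ge>0. D t \<union> D (inv t) \<subseteq> slab s X1 c"
  proof (rule uniform_slab_bound)
    show "finite (D t \<union> D (inv t))" using X1_fin by (simp add: D_def)
    show "\<exists>r\<ge>0. a \<in> slab s X1 r" if "a \<in> D t \<union> D (inv t)" for a
      using that D_slab[of a t] D_slab[of a "inv t"] tc by blast
  qed
  then obtain c where c: "c \<ge> 0" "D t \<subseteq> slab s X1 c" "D (inv t) \<subseteq> slab s X1 c" by auto
  have growth: "conjugate g (conjugate (s [^] (k :: int)) x) \<in> slab s X1 (\<bar>k\<bar> + c)"
    if "D g \<subseteq> slab s X1 c" "g \<in> carrier G" "x \<in> X1" for g k x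
    by (rule conjugate_slab_growth[OF sc X1_c that(2) c(1) _ _ that(3)]) (use that(1) in \<open>auto simp: D_def\<close>)
  define m where "m = c + 1"
  define \<phi> where "\<phi> g = \<chi> g + m * e g" for g
  have \<phi>: "\<phi> \<in> hom G integer_group"
    using \<chi>.hom_mult e.hom_mult by (auto simp: hom_def \<phi>_def algebra_simps)
  interpret \<phi>: group_hom G integer_group \<phi> using is_group \<phi> by (rule group_hom_integerI)
  have \<phi>_H: "\<phi> h = \<chi> h" if "h \<in> H" for h using e_H[OF that] by (simp add: \<phi>_def)
  have \<phi>_t: "\<phi> t = m" using t \<chi>(2) by (simp add: \<phi>_def)
  have \<phi>_pow: "\<phi> (s [^] j) = j" for j :: int by (simp add: \<phi>_def \<chi>_pow e_pow)
  define K where "K = kernel G integer_group \<phi>"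
  have K: "subgroup K G" unfolding K_def by (rule \<phi>.subgroup_kernel)
  \<comment> \<open>The elements \<open>s\<^bsup>-\<phi> a\<^esup> a\<close> map to generators of the quotient. For \<open>a = t\<close> the inverse of this
    element is the conjugator \<open>t\<^bsup>-1\<^esup> s\<^bsup>m\<^esup>\<close> needed at the lower end of the slabs; the one for the
    upper end is added separately.\<close>
  define A where "A = slab_gens s X1 m \<union> insert (t \<otimes> s [^] (- m)) ((\<lambda>a. s [^] (- \<phi> a) \<otimes> a) ` T)"
  define L where "L = generate G A"
  have A_fin: "finite A" using T(1) X1_fin by (simp add: A_def finite_slab_gens)
  have A_K: "A \<subseteq> K"
  proof -
    have "slab_gens s X1 m \<subseteq> K"
      using X1_c sc X1_H \<phi>_H integer_hom_conjugate[OF \<phi>] by (auto simp: K_def kernel_def slab_gens_def)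
    moreover have "t \<otimes> s [^] (- m) \<in> K"
      using tc sc \<phi>.hom_mult[of t "s [^] (- m)"] \<phi>_pow[of "- m"] \<phi>_t by (simp add: K_def kernel_def)
    moreover have "s [^] (- \<phi> a) \<otimes> a \<in> K" if "a \<in> T" for a
      using T(2) that sc \<phi>.hom_mult[of "s [^] (- \<phi> a)" a] \<phi>_pow[of "- \<phi> a"] by (auto simp: K_def kernel_def)
    ultimately show ?thesis by (auto simp: A_def)
  qed
  then have A_c: "A \<subseteq> carrier G" using subgroup.subset[OF K] by blast
  have L: "subgroup L G" unfolding L_def by (rule generate_is_subgroup[OF A_c])
  have L_K: "L \<subseteq> K" unfolding L_def by (rule generate_subgroup_incl[OF A_K K])
  have lift_L: "s [^] (- \<phi> a) \<otimes> a \<in> L" if "a \<in> T" for a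
    using that by (auto simp: L_def A_def intro: generate.incl)
  have slab_L: "slab s X1 r \<subseteq> L" for r
  proof (rule slab_subset_if_conjugators[OF sc X1_c tc L c(1)])
    show "c < m" by (simp add: m_def)
    show "slab_gens s X1 m \<subseteq> L" "t \<otimes> s [^] (- m) \<in> L"
      by (auto simp: L_def A_def intro: generate.incl)
    have "inv (s [^] (- m) \<otimes> t) \<in> L"
      using lift_L[OF t(1)] \<phi>_t subgroup.m_inv_closed[OF L] by simp
    then show "inv t \<otimes> s [^] m \<in> L" using sc tc by (simp add: inv_mult_group int_pow_neg)
  qed (use growth c tc in auto)
  have HL: "carrier G \<subseteq> H <#> L"
  proof -
    have "a \<in> H <#> L" if "a \<in> S" for a
      using S_H[OF that] subgroup.one_closed[OF L] Hc[OF S_H[OF that]] by (force simp: set_mult_def)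
    moreover have "a \<in> H <#> L" if "a \<in> T" for a
    proof -
      have "a = s [^] \<phi> a \<otimes> (s [^] (- \<phi> a) \<otimes> a)"
        using T(2) that sc by (auto simp: int_pow_neg)
      then show ?thesis
        using lift_L[OF that] subgroup_int_pow_closed[OF H s_H] by (force simp: set_mult_def)
    qed
    ultimately have "S \<union> T \<subseteq> H <#> L" by blast
    moreover have "subgroup (H <#> L) G" unfolding H_def by (rule mult_norm_subgroup[OF normal L])
    ultimately show ?thesis unfolding ST[symmetric] by (rule generate_subgroup_incl)
  qed
  \<comment> \<open>If \<open>h l\<close> lies in \<open>K\<close> and \<open>l\<close> in \<open>L\<close>, then \<open>h\<close> lies in the kernel of \<open>\<chi>\<close> on \<open>H\<close>, a union of slabs.\<close>
  have "K \<subseteq> L"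
  proof
    fix g assume g: "g \<in> K"
    then have gc: "g \<in> carrier G" by (rule subgroup.mem_carrier[OF K])
    then obtain h l where hl: "h \<in> H" "l \<in> L" "g = h \<otimes> l" using HL by (auto simp: set_mult_def)
    then have "\<phi> h = 0"
      using g L_K Hc[OF hl(1)] \<phi>.hom_mult[of h l] by (auto simp: K_def kernel_def)
    then have "h \<in> L" using in_slab[OF hl(1)] \<phi>_H[OF hl(1)] slab_L by auto
    then show "g \<in> L" using hl subgroup.m_closed[OF L] by simp
  qed
  with L_K have KL: "K = L" by blast
  have "generate (G\<lparr>carrier := K\<rparr>) A = K"
    using generate_consistent[OF A_K K] KL by (simp add: L_def)
  then have "finitely_generated (G\<lparr>carrier := K\<rparr>)"
    unfolding finitely_generated_def using A_fin A_K by (intro exI[of _ A]) simp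
  moreover have "\<phi> ` carrier G = carrier integer_group"
    using \<phi>_pow sc by (auto intro!: image_eqI[of _ _ "s [^] (_ :: int)"])
  ultimately show ?thesis
    unfolding algebraically_fibers_def epi_def K_def using \<phi> by (intro bexI[of _ \<phi>]) simp_all
qed

section \<open>Real homomorphisms and the first cohomology\<close>

lemma INF_enat_attained:
  assumes "(INF x \<in> A. enat (f x)) = enat n"
  obtains x where "x \<in> A" "f x = n"
proof -
  have "A \<noteq> {}" using assms by (auto simp: top_enat_def)
  then have "(INF x \<in> A. enat (f x)) \<in> (\<lambda>x. enat (f x)) ` A"
    by (auto intro: wellorder_InfI)
  then show ?thesis using assms that by auto
qed

text \<open>A 1-cocycle with trivial coefficients is a homomorphism to \<open>\<real>\<close>, extended by 0.\<close>

lemma cocycle1_one: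
  assumes "group G" "f \<in> cocycles1 G (\<lambda>_ r. r)"
  shows "f \<one>\<^bsub>G\<^esub> = 0"
proof -
  interpret group G by fact
  have "f (\<one>\<^bsub>G\<^esub> \<otimes>\<^bsub>G\<^esub> \<one>\<^bsub>G\<^esub>) = f \<one>\<^bsub>G\<^esub> + f \<one>\<^bsub>G\<^esub>" using assms(2) unfolding cocycles1_trivial_iff by blast
  then show ?thesis by simp
qed

lemma cocycle1_inv:
  assumes "group G" "f \<in> cocycles1 G (\<lambda>_ r. r)" "a \<in> carrier G"
  shows "f (inv\<^bsub>G\<^esub> a) = - f a"
proof -
  interpret group G by fact
  have "f (a \<otimes>\<^bsub>G\<^esub> inv\<^bsub>G\<^esub> a) = f a + f (inv\<^bsub>G\<^esub> a)"
    using assms(2,3) inv_closed[OF assms(3)] unfolding cocycles1_trivial_iff by blast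
  then show ?thesis using cocycle1_one[OF assms(1,2)] assms(3) by simp
qed

lemma subgroup_vimage_cocycle1:
  assumes "group G" "f \<in> cocycles1 G (\<lambda>_ r. r)"
    and "0 \<in> U" "\<And>u v. u \<in> U \<Longrightarrow> v \<in> U \<Longrightarrow> u + v \<in> U" "\<And>u. u \<in> U \<Longrightarrow> - u \<in> U"
  shows "subgroup {a \<in> carrier G. f a \<in> U} G"
proof -
  interpret group G by fact
  have "f (a \<otimes>\<^bsub>G\<^esub> b) = f a + f b" if "a \<in> carrier G" "b \<in> carrier G" for a b
    using assms(2) that unfolding cocycles1_trivial_iff by blast
  then show ?thesis
    using assms(3-5) cocycle1_one[OF assms(1,2)] cocycle1_inv[OF assms(1,2)]
    by (intro subgroup.intro) auto
qed

lemma cocycle1_mem_if_generated: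
  assumes "group G" "f \<in> cocycles1 G (\<lambda>_ r. r)"
    and "0 \<in> U" "\<And>u v. u \<in> U \<Longrightarrow> v \<in> U \<Longrightarrow> u + v \<in> U" "\<And>u. u \<in> U \<Longrightarrow> - u \<in> U"
    and "generate G A = carrier G" "A \<subseteq> carrier G" "\<And>a. a \<in> A \<Longrightarrow> f a \<in> U" "a \<in> carrier G"
  shows "f a \<in> U"
  using group.generate_subgroup_incl[OF assms(1) _ subgroup_vimage_cocycle1[OF assms(1-5)], of A]
    assms(6-9) by blast

lemma subspace_cocycles1: "fun_space.subspace (cocycles1 G (\<lambda>_ r. r))"
  by (auto simp: fun_space.subspace_def cocycles1_trivial_iff algebra_simps)

text \<open>Restriction to the generating set \<open>T\<close> is injective on homomorphisms to \<open>\<real>\<close>, so when the space of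
  homomorphisms has dimension \<open>card T\<close>, restriction is an isomorphism onto the real functions on
  \<open>T\<close>.\<close>

lemma exists_cocycle1_with_values:
  fixes Q :: "'a monoid" and v :: "'a \<Rightarrow> real"
  assumes Q: "group Q" and T: "finite T" "T \<subseteq> carrier Q" "generate Q T = carrier Q"
    and rk: "rk_H1 Q = enat (card T)"
  obtains f where "f \<in> cocycles1 Q (\<lambda>_ r. r)" "\<And>x. x \<in> T \<Longrightarrow> f x = v x"
proof -
  define V where "V = cocycles1 Q (\<lambda>_ r. r)"
  \<comment> \<open>Restriction to \<open>T\<close>, extended by 0 so that it stays within functions on the whole type.\<close>
  define \<rho> :: "('a \<Rightarrow> real) \<Rightarrow> 'a \<Rightarrow> real" where "\<rho> f = (\<lambda>x. if x \<in> T then f x else 0)" for f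
  define \<delta> :: "'a \<Rightarrow> 'a \<Rightarrow> real" where "\<delta> a = (\<lambda>x. if x = a then 1 else 0)" for a
  interpret \<rho>: module_hom "\<lambda>(c::real) (f :: 'a \<Rightarrow> real) x. c * f x" "\<lambda>(c::real) (f :: 'a \<Rightarrow> real) x. c * f x" \<rho>
    by unfold_locales (auto simp: \<rho>_def fun_eq_iff algebra_simps)
  obtain B where B: "B \<subseteq> V" "fun_space.independent B" "V \<subseteq> fun_space.span B"
    using fun_space.maximal_independent_subset by blast
  have span_B: "fun_space.span B = V"
    using B fun_space.span_minimal[OF B(1)] subspace_cocycles1[of Q] by (auto simp: V_def)
  have inj: "inj_on \<rho> (fun_space.span B)"
  proof (rule inj_onI)
    fix f g assume fg: "f \<in> fun_space.span B" "g \<in> fun_space.span B" "\<rho> f = \<rho> g"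
    have "f - g \<in> V" using fg fun_space.span_diff unfolding span_B[symmetric] by blast
    moreover have "(f - g) x = 0" if "x \<in> T" for x
      using fun_cong[OF fg(3), of x] that by (simp add: \<rho>_def)
    ultimately have "(f - g) x \<in> {0}" if "x \<in> carrier Q" for x
      using cocycle1_mem_if_generated[OF Q, of "f - g" "{0}" T] T that by (simp add: V_def)
    moreover have "(f - g) x = 0" if "x \<notin> carrier Q" for x
      using \<open>f - g \<in> V\<close> that unfolding V_def cocycles1_trivial_iff by blast
    ultimately have "(f - g) x = 0" for x by blast
    then show "f = g" by (simp add: fun_eq_iff)
  qed
  have delta_span: "\<rho> f \<in> fun_space.span (\<delta> ` T)" for f
  proof -
    have "\<rho> f = (\<Sum>a\<in>T. (\<lambda>x. f a * \<delta> a x))"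
    proof
      fix x
      have "(\<Sum>a\<in>T. (\<lambda>x. f a * \<delta> a x)) x = (\<Sum>a\<in>T. f a * \<delta> a x)"
        using T(1) by (induction T rule: finite_induct) auto
      also have "\<dots> = (\<Sum>a\<in>T. if a = x then f x else 0)"
        by (rule sum.cong) (auto simp: \<delta>_def)
      also have "\<dots> = \<rho> f x" using T(1) by (simp add: \<rho>_def)
      finally show "\<rho> f x = (\<Sum>a\<in>T. (\<lambda>x. f a * \<delta> a x)) x" by simp
    qed
    moreover have "(\<Sum>a\<in>T. (\<lambda>x. f a * \<delta> a x)) \<in> fun_space.span (\<delta> ` T)"
      by (intro fun_space.span_sum fun_space.span_scale fun_space.span_base imageI)
    ultimately show ?thesis by simp
  qed
  have indep: "fun_space.independent (\<rho> ` B)"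
    by (rule \<rho>.independent_injective_image[OF B(2) inj])
  have fin_delta: "finite (\<delta> ` T)" and card_delta: "card (\<delta> ` T) \<le> card T"
    using T(1) by (auto intro: card_image_le)
  have "finite (\<rho> ` B)"
    using fun_space.independent_span_bound[OF fin_delta indep] delta_span by (simp add: image_subset_iff)
  moreover have inj_B: "inj_on \<rho> B" using inj fun_space.span_superset by (rule inj_on_subset)
  ultimately have fin_B: "finite B" by (simp add: finite_image_iff)
  have card_B: "card (\<rho> ` B) = card T"
    using rk_H1_eq_card_basis[OF fin_B B(2), of Q] span_B rk card_image[OF inj_B] by (simp add: V_def)
  have "\<rho> v \<in> fun_space.span (\<rho> ` B)"
  proof (rule ccontr)
    assume not_span: "\<rho> v \<notin> fun_space.span (\<rho> ` B)"
    then have "\<rho> v \<notin> \<rho> ` B" using fun_space.span_base[of "\<rho> v" "\<rho> ` B"] by argo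
    then have "card (insert (\<rho> v) (\<rho> ` B)) = Suc (card T)" using fin_B card_B by simp
    moreover have "card (insert (\<rho> v) (\<rho> ` B)) \<le> card (\<delta> ` T)"
      using fun_space.independent_span_bound[OF fin_delta fun_space.independent_insertI[OF not_span indep]]
        delta_span by (simp add: image_subset_iff)
    ultimately show False using card_delta by simp
  qed
  then obtain f where "f \<in> V" "\<rho> v = \<rho> f" unfolding \<rho>.span_image span_B by blast
  then show ?thesis using that[of f] by (auto simp: V_def \<rho>_def fun_eq_iff split: if_splits)
qed

text \<open>Homomorphisms that vanish on the kernel of \<open>\<pi>\<close> factor through \<open>Q\<close>. If this held for all of them,
  a spanning set for \<open>Q\<close> would pull back to one for \<open>G\<close>.\<close>

lemma exists_cocycle1_nonzero_on_kernel:
  fixes G :: "'g monoid" and Q :: "'q monoid"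
  assumes G: "group G" and Q: "group Q" and \<pi>: "\<pi> \<in> epi G Q"
    and rk: "rk_H1 Q < rk_H1 G"
  obtains f k where "f \<in> cocycles1 G (\<lambda>_ r. r)" "k \<in> kernel G Q \<pi>" "f k \<noteq> 0"
proof (rule ccontr)
  assume "\<not> thesis"
  with that have vanish: "f k = 0" if "f \<in> cocycles1 G (\<lambda>_ r. r)" "k \<in> kernel G Q \<pi>" for f k
    using that by blast
  interpret G: group G by fact
  interpret Q: group Q by fact
  have "\<pi> \<in> hom G Q" and \<pi>_surj: "\<pi> ` carrier G = carrier Q" using \<pi> by (auto simp: epi_def)
  then interpret \<pi>: group_hom G Q \<pi> by (unfold_locales) simp
  let ?VG = "cocycles1 G (\<lambda>_ r. r)" and ?VQ = "cocycles1 Q (\<lambda>_ r. r)"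
  define P :: "('q \<Rightarrow> real) \<Rightarrow> 'g \<Rightarrow> real" where "P f = (\<lambda>g. if g \<in> carrier G then f (\<pi> g) else 0)" for f
  interpret P: module_hom "\<lambda>(c::real) (f :: 'q \<Rightarrow> real) x. c * f x" "\<lambda>(c::real) (f :: 'g \<Rightarrow> real) x. c * f x" P
    by unfold_locales (auto simp: P_def fun_eq_iff algebra_simps)
  have P_V: "P f \<in> ?VG" if "f \<in> ?VQ" for f
    using that by (auto simp: P_def cocycles1_trivial_iff)
  have V_P: "F \<in> P ` ?VQ" if F: "F \<in> ?VG" for F
  proof -
    have F_mult: "F (a \<otimes>\<^bsub>G\<^esub> b) = F a + F b" if "a \<in> carrier G" "b \<in> carrier G" for a b
      using F that unfolding cocycles1_trivial_iff by blast
    define \<sigma> where "\<sigma> = inv_into (carrier G) \<pi>"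
    have \<sigma>: "\<sigma> q \<in> carrier G" "\<pi> (\<sigma> q) = q" if "q \<in> carrier Q" for q
      using that \<pi>_surj by (auto simp: \<sigma>_def inv_into_into f_inv_into_f)
    have fibre: "F a = F b" if ab: "a \<in> carrier G" "b \<in> carrier G" "\<pi> a = \<pi> b" for a b
    proof -
      have "a \<otimes>\<^bsub>G\<^esub> inv\<^bsub>G\<^esub> b \<in> kernel G Q \<pi>" using ab by (simp add: kernel_def)
      then have "F (a \<otimes>\<^bsub>G\<^esub> inv\<^bsub>G\<^esub> b) = 0" by (rule vanish[OF F])
      then show ?thesis using ab F_mult cocycle1_inv[OF G F] by simp
    qed
    define f where "f q = (if q \<in> carrier Q then F (\<sigma> q) else 0)" for q
    have "F (\<sigma> (p \<otimes>\<^bsub>Q\<^esub> q)) = F (\<sigma> p) + F (\<sigma> q)" if "p \<in> carrier Q" "q \<in> carrier Q" for p q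
    proof -
      have "F (\<sigma> (p \<otimes>\<^bsub>Q\<^esub> q)) = F (\<sigma> p \<otimes>\<^bsub>G\<^esub> \<sigma> q)" by (rule fibre) (use that \<sigma> in auto)
      then show ?thesis using F_mult that \<sigma> by simp
    qed
    then have "f \<in> ?VQ" by (auto simp: f_def cocycles1_trivial_iff)
    moreover have "F = P f"
    proof
      fix g
      have "F g = F (\<sigma> (\<pi> g))" if "g \<in> carrier G" using that by (intro fibre) (use \<sigma> in auto)
      moreover have "F g = 0" if "g \<notin> carrier G" using F that unfolding cocycles1_trivial_iff by blast
      ultimately show "F g = P f g" by (auto simp: P_def f_def)
    qed
    ultimately show ?thesis by blast
  qed
  have "rk_H1 G \<le> enat (card S)"
    if S: "finite S" "S \<subseteq> ?VQ" "?VQ \<subseteq> fun_space.span (S \<union> {0})" for S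
  proof -
    have "?VG \<subseteq> P ` fun_space.span (S \<union> {0})" using V_P S(3) by blast
    also have "\<dots> = fun_space.span (P ` S \<union> {0})"
      unfolding P.span_image[symmetric] by simp
    finally have "rk_H1 G \<le> enat (card (P ` S))"
      unfolding rk_H1_def quotient_dim_def coboundaries1_trivial
      using S P_V by (intro INF_lower) auto
    also have "\<dots> \<le> enat (card S)" using S(1) by (simp add: card_image_le)
    finally show ?thesis .
  qed
  then have "rk_H1 G \<le> rk_H1 Q"
    unfolding rk_H1_def[of Q] quotient_dim_def coboundaries1_trivial by (intro INF_greatest) auto
  then show False using rk by simp
qed

section \<open>From real to integral homomorphisms\<close>

text \<open>Here \<open>f\<close> takes integer values on all of \<open>G\<close>; the floor only changes the codomain.\<close>

lemma floor_cocycle1_hom: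
  assumes G: "group G" and A: "A \<subseteq> carrier G" "generate G A = carrier G"
    and f: "f \<in> cocycles1 G (\<lambda>_ r. r)" and int: "\<And>a. a \<in> A \<Longrightarrow> f a \<in> \<int>"
  shows "(\<lambda>g. \<lfloor>f g\<rfloor>) \<in> hom G integer_group"
proof -
  have f_int: "f a \<in> \<int>" if "a \<in> carrier G" for a
    by (rule cocycle1_mem_if_generated[OF G f _ _ _ A(2,1)]) (auto intro: int that)
  show ?thesis
  proof (rule homI)
    fix a b assume ab: "a \<in> carrier G" "b \<in> carrier G"
    then have "f (a \<otimes>\<^bsub>G\<^esub> b) = f a + f b"
      using f unfolding cocycles1_trivial_iff by blast
    moreover obtain i where "f a = of_int i" using f_int[OF ab(1)] by (rule Ints_cases)
    ultimately show "\<lfloor>f (a \<otimes>\<^bsub>G\<^esub> b)\<rfloor> = \<lfloor>f a\<rfloor> \<otimes>\<^bsub>integer_group\<^esub> \<lfloor>f b\<rfloor>" by simp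
  qed simp
qed

lemma common_denominator:
  fixes q :: "'a \<Rightarrow> rat"
  assumes "finite A"
  shows "\<exists>d>0. \<forall>a\<in>A. of_int d * q a \<in> \<int>"
  using assms
proof (induction A)
  case empty
  then show ?case by (auto intro: exI[of _ 1])
next
  case (insert a A)
  then obtain d where d: "d > 0" "\<forall>a\<in>A. of_int d * q a \<in> \<int>" by blast
  obtain m k where q: "q a = of_int m / of_int k" and k: "k > 0"
    by (metis Rat_cases Fract_of_int_quotient)
  have "of_int (k * d) * q b \<in> \<int>" if "b \<in> A" for b
  proof -
    have "of_int k * (of_int d * q b) \<in> \<int>" using d(2) that by (simp add: Ints_mult)
    then show ?thesis by (simp only: mult.assoc of_int_mult)
  qed
  moreover have "of_int (k * d) * q a = of_int (d * m)" using q k by simp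
  then have "of_int (k * d) * q a \<in> \<int>" by (simp only: Ints_of_int)
  ultimately have "\<forall>b\<in>insert a A. of_int (k * d) * q b \<in> \<int>" by blast
  moreover have "k * d > 0" using d(1) k by simp
  ultimately show ?case by blast
qed

text \<open>The values of \<open>f\<close> may be linearly independent over \<open>\<rat>\<close>, so scaling does not make them integral.
  Instead \<open>f\<close> is followed by a \<open>\<rat>\<close>-linear functional \<open>l\<close> on \<open>\<real>\<close> with \<open>l (f k) = 1\<close>; its values on the
  finitely many generators have a common denominator.\<close>

lemma integral_cocycle1:
  assumes G: "group G" and A: "finite A" "A \<subseteq> carrier G" "generate G A = carrier G"
    and f: "f \<in> cocycles1 G (\<lambda>_ r. r)" and k: "k \<in> carrier G" "f k \<noteq> 0"
  obtains \<psi> where "\<psi> \<in> hom G integer_group" "\<psi> k \<noteq> 0" "\<And>g. f g = 0 \<Longrightarrow> \<psi> g = 0"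
proof -
  interpret R: vector_space "\<lambda>(q::rat) (x::real). of_rat q * x"
    by unfold_locales (auto simp: algebra_simps of_rat_add of_rat_mult)
  interpret QQ: vector_space "\<lambda>(q::rat) (x::rat). q * x"
    by unfold_locales (auto simp: algebra_simps)
  interpret RQ: vector_space_pair "\<lambda>(q::rat) (x::real). of_rat q * x" "\<lambda>(q::rat) (x::rat). q * x" ..
  have "R.independent {f k}" using k by simp
  from RQ.linear_independent_extend[OF this, of "\<lambda>_. 1"] obtain l
    where l: "Vector_Spaces.linear (\<lambda>(q::rat) (x::real). of_rat q * x) (\<lambda>(q::rat) (x::rat). q * x) l" "l (f k) = 1"
    by auto
  interpret l: Vector_Spaces.linear "\<lambda>(q::rat) (x::real). of_rat q * x" "\<lambda>(q::rat) (x::rat). q * x" l by (rule l)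
  obtain d where d: "d > 0" "\<forall>a\<in>A. of_int d * l (f a) \<in> \<int>"
    using common_denominator[OF A(1), of "\<lambda>a. l (f a)"] by auto
  define F :: "_ \<Rightarrow> real" where "F g = of_rat (of_int d * l (f g))" for g
  have F: "F \<in> cocycles1 G (\<lambda>_ r. r)"
    using f by (auto simp: cocycles1_trivial_iff F_def l.zero l.add algebra_simps of_rat_add)
  have "F a \<in> \<int>" if "a \<in> A" for a
    using d(2) that by (auto simp: F_def elim!: Ints_cases)
  then have "(\<lambda>g. \<lfloor>F g\<rfloor>) \<in> hom G integer_group"
    by (rule floor_cocycle1_hom[OF G A(2,3) F])
  moreover have "F k = of_int d" using l(2) by (simp add: F_def)
  moreover have "F g = 0" if "f g = 0" for g using that by (simp add: F_def l.zero)
  ultimately show ?thesis using that d(1) by simp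
qed

text \<open>Let \<open>d\<close> be the least positive value of \<open>\<psi>\<close> on \<open>generate G S\<close>. Since \<open>\<psi>\<close> vanishes on \<open>T\<close>, the image of
  the whole group is generated by the values on \<open>S\<close>, so \<open>d\<close> divides all values and \<open>\<psi>\<close> can be
  divided by it.\<close>

lemma normalise_integer_hom:
  assumes G: "group G" and S: "S \<subseteq> carrier G" and T: "T \<subseteq> carrier G"
    and ST: "generate G (S \<union> T) = carrier G"
    and \<psi>: "\<psi> \<in> hom G integer_group" "\<And>t. t \<in> T \<Longrightarrow> \<psi> t = 0"
    and k: "k \<in> generate G S" "\<psi> k \<noteq> 0"
  obtains \<chi> s where "\<chi> \<in> hom G integer_group" "\<And>t. t \<in> T \<Longrightarrow> \<chi> t = 0"
    "s \<in> generate G S" "\<chi> s = 1"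
proof -
  interpret group G by fact
  interpret \<psi>: group_hom G integer_group \<psi> by (rule group_hom_integerI[OF G \<psi>(1)])
  let ?H = "generate G S"
  have H: "subgroup ?H G" by (rule generate_is_subgroup[OF S])
  have Hc: "a \<in> carrier G" if "a \<in> ?H" for a using that by (rule subgroup.mem_carrier[OF H])
  define pos where "pos d \<longleftrightarrow> d > 0 \<and> (\<exists>s\<in>?H. \<psi> s = int d)" for d
  have "pos (nat \<bar>\<psi> k\<bar>)"
  proof (cases "\<psi> k > 0")
    case True
    then show ?thesis using k by (auto simp: pos_def)
  next
    case False
    then have "\<psi> (inv\<^bsub>G\<^esub> k) = \<bar>\<psi> k\<bar>" using \<psi>.hom_inv[OF Hc[OF k(1)]] by simp
    then show ?thesis using k subgroup.m_inv_closed[OF H k(1)] by (auto simp: pos_def)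
  qed
  define d where "d = (LEAST d. pos d)"
  have "pos d" unfolding d_def by (rule LeastI) fact
  then obtain s where d: "d > 0" and s: "s \<in> ?H" "\<psi> s = int d" by (auto simp: pos_def)
  have dvd_H: "int d dvd \<psi> h" if h: "h \<in> ?H" for h
  proof (rule ccontr)
    assume "\<not> int d dvd \<psi> h"
    then have "\<psi> h mod int d \<noteq> 0" by (simp add: dvd_eq_mod_eq_0)
    moreover have "0 \<le> \<psi> h mod int d" "\<psi> h mod int d < int d" using d by simp_all
    ultimately have r: "0 < \<psi> h mod int d" "\<psi> h mod int d < int d" by linarith+
    define h' where "h' = h \<otimes>\<^bsub>G\<^esub> s [^]\<^bsub>G\<^esub> (- (\<psi> h div int d))"
    have "h' \<in> ?H"
      unfolding h'_def by (intro subgroup.m_closed[OF H] h subgroup_int_pow_closed[OF H] s)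
    moreover have "\<psi> (s [^]\<^bsub>G\<^esub> j) = j * int d" for j :: int
      using \<psi>.hom_int_pow[of s j] Hc[OF s(1)] s(2) by simp
    then have "\<psi> h' = \<psi> h mod int d"
      using Hc[OF h] Hc[OF s(1)] \<psi>.hom_mult
      by (simp add: h'_def minus_div_mult_eq_mod[symmetric])
    ultimately have "pos (nat (\<psi> h mod int d))" using r by (auto simp: pos_def)
    then have "d \<le> nat (\<psi> h mod int d)" unfolding d_def by (rule Least_le)
    then show False using r by linarith
  qed
  have dvd: "int d dvd \<psi> g" if "g \<in> carrier G" for g
    using that unfolding ST[symmetric]
  proof induction
    case one
    then show ?case using \<psi>.hom_one by simp
  next
    case (incl h)
    then show ?case using dvd_H generate.incl[of h S G] \<psi>(2) by auto
  next
    case (inv h)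
    then have "int d dvd \<psi> h" using dvd_H generate.incl[of h S G] \<psi>(2) by auto
    then show ?case using inv S T \<psi>.hom_inv[of h] by auto
  next
    case (eng a b)
    then show ?case using \<psi>.hom_mult[of a b] by (simp add: ST)
  qed
  have "(\<lambda>g. \<psi> g div int d) \<in> hom G integer_group"
    using dvd \<psi>.hom_mult by (auto simp: hom_def)
  then show ?thesis using that[of "\<lambda>g. \<psi> g div int d" s] s d \<psi>(2) by simp
qed

section \<open>Groups with excessive first cohomology\<close>

theorem theorem5p3:
  fixes H :: "'h monoid" and G :: "'g monoid" and Q :: "'q monoid"
    and \<iota> :: "'h \<Rightarrow> 'g" and \<pi> :: "'g \<Rightarrow> 'q" and n :: nat
  assumes "n \<ge> 1"
    and "group_extension H \<iota> G \<pi> Q"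
    and "finitely_generated H"
    and "group_rank Q = enat n"
    and "rk_H1 Q = enat n"
    and "rk_H1 G > enat n"
  shows "algebraically_fibers G"
proof -
  have H: "group H" and G: "group G" and Q: "group Q" and \<iota>: "\<iota> \<in> hom H G"
    and \<pi>_epi: "\<pi> \<in> epi G Q" and exact: "\<iota> ` carrier H = kernel G Q \<pi>"
    using assms(2) by (auto simp: group_extension_def mon_def)
  have \<pi>: "\<pi> \<in> hom G Q" and \<pi>_surj: "\<pi> ` carrier G = carrier Q" using \<pi>_epi by (auto simp: epi_def)
  interpret G: group G by (rule G)
  interpret \<iota>: group_hom H G \<iota> using H G \<iota> by (simp add: group_hom_def group_hom_axioms_def)
  interpret \<pi>: group_hom G Q \<pi> using G Q \<pi> by (simp add: group_hom_def group_hom_axioms_def)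
  obtain S0 where S0: "finite S0" "S0 \<subseteq> carrier H" "generate H S0 = carrier H"
    using assms(3) by (auto simp: finitely_generated_def)
  define S where "S = \<iota> ` S0"
  have S: "finite S" "S \<subseteq> carrier G" using S0 by (auto simp: S_def)
  have gen_S: "generate G S = kernel G Q \<pi>"
    using \<iota>.generate_img[OF S0(2)] S0(3) exact by (simp add: S_def)
  obtain TQ where TQ: "finite TQ" "TQ \<subseteq> carrier Q" "generate Q TQ = carrier Q" "card TQ = n"
    using assms(4) unfolding group_rank_def by (auto elim: INF_enat_attained)
  have rk_Q: "rk_H1 Q = enat (card TQ)" using assms(5) TQ(4) by simp
  define \<tau> where "\<tau> = inv_into (carrier G) \<pi>"
  have \<tau>: "\<tau> q \<in> carrier G" "\<pi> (\<tau> q) = q" if "q \<in> TQ" for q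
    using that TQ(2) \<pi>_surj by (auto simp: \<tau>_def inv_into_into f_inv_into_f)
  define T where "T = \<tau> ` TQ"
  have T: "finite T" "T \<subseteq> carrier G" using TQ \<tau> by (auto simp: T_def)
  have \<pi>_T: "\<pi> ` T = TQ" using \<tau> by (force simp: T_def)
  have ST: "generate G (S \<union> T) = carrier G"
  proof
    show "generate G (S \<union> T) \<subseteq> carrier G" by (rule G.generate_incl) (use S T in auto)
    show "carrier G \<subseteq> generate G (S \<union> T)"
    proof
      fix g assume g: "g \<in> carrier G"
      then have "\<pi> g \<in> \<pi> ` generate G T"
        using \<pi>.generate_img[OF T(2)] \<pi>_T TQ(3) \<pi>.hom_closed[OF g] by simp
      then obtain l where l: "l \<in> generate G T" "\<pi> l = \<pi> g" by auto
      have lc: "l \<in> carrier G" using G.generate_in_carrier[OF T(2) l(1)] .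
      have "inv\<^bsub>G\<^esub> l \<otimes>\<^bsub>G\<^esub> g \<in> generate G S"
        unfolding gen_S using g lc l(2) by (simp add: kernel_def)
      then have "l \<otimes>\<^bsub>G\<^esub> (inv\<^bsub>G\<^esub> l \<otimes>\<^bsub>G\<^esub> g) \<in> generate G (S \<union> T)"
        using generate.eng[of l G "S \<union> T" "inv\<^bsub>G\<^esub> l \<otimes>\<^bsub>G\<^esub> g"] l(1)
          G.mono_generate[of S "S \<union> T"] G.mono_generate[of T "S \<union> T"] by blast
      then show "g \<in> generate G (S \<union> T)" using g lc by simp
    qed
  qed
  obtain F k where F: "F \<in> cocycles1 G (\<lambda>_ r. r)" and k: "k \<in> kernel G Q \<pi>" "F k \<noteq> 0"
    using exists_cocycle1_nonzero_on_kernel[OF G Q \<pi>_epi] assms(5,6) by auto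
  obtain f where f: "f \<in> cocycles1 Q (\<lambda>_ r. r)" "\<And>q. q \<in> TQ \<Longrightarrow> f q = F (\<tau> q)"
    using exists_cocycle1_with_values[OF Q TQ(1-3) rk_Q, of "\<lambda>q. F (\<tau> q)"] by blast
  \<comment> \<open>Correct \<open>F\<close> by a homomorphism from \<open>Q\<close>, which leaves it unchanged on the kernel of \<open>\<pi>\<close>.\<close>
  define F' where "F' g = (if g \<in> carrier G then F g - f (\<pi> g) else 0)" for g
  have F': "F' \<in> cocycles1 G (\<lambda>_ r. r)"
    using F f(1) by (auto simp: cocycles1_trivial_iff F'_def)
  have kc: "k \<in> carrier G" and "\<pi> k = \<one>\<^bsub>Q\<^esub>" using k(1) by (auto simp: kernel_def)
  then have F'_k: "F' k \<noteq> 0" using k(2) cocycle1_one[OF Q f(1)] by (simp add: F'_def)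
  have F'_T: "F' a = 0" if "a \<in> T" for a using that \<tau> f(2) by (auto simp: T_def F'_def)
  obtain \<psi> where \<psi>: "\<psi> \<in> hom G integer_group" "\<psi> k \<noteq> 0" "\<And>g. F' g = 0 \<Longrightarrow> \<psi> g = 0"
    using integral_cocycle1[OF G _ _ ST F' kc F'_k] S T by blast
  obtain \<chi> s where \<chi>: "\<chi> \<in> hom G integer_group" "\<And>a. a \<in> T \<Longrightarrow> \<chi> a = 0"
      and s: "s \<in> generate G S" "\<chi> s = 1"
    using normalise_integer_hom[OF G S(2) T(2) ST \<psi>(1) _ _ \<psi>(2)] \<psi>(3) F'_T k(1) gen_S by blast
  \<comment> \<open>The assumption \<open>n \<ge> 1\<close> provides a generator to carry the homomorphism with value 1.\<close>
  obtain q where q: "q \<in> TQ" using assms(1) TQ(4) by (cases "TQ = {}") auto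
  obtain f1 where f1: "f1 \<in> cocycles1 Q (\<lambda>_ r. r)" "\<And>x. x \<in> TQ \<Longrightarrow> f1 x = (if x = q then 1 else 0)"
    using exists_cocycle1_with_values[OF Q TQ(1-3) rk_Q, of "\<lambda>x. if x = q then 1 else 0"] by blast
  have "(\<lambda>x. \<lfloor>f1 x\<rfloor>) \<in> hom Q integer_group"
    by (rule floor_cocycle1_hom[OF Q TQ(2,3) f1(1)]) (simp add: f1(2))
  then have e: "(\<lambda>g. \<lfloor>f1 (\<pi> g)\<rfloor>) \<in> hom G integer_group"
    using hom_compose[OF \<pi>, of "\<lambda>x. \<lfloor>f1 x\<rfloor>"] by (simp add: o_def)
  show ?thesis
  proof (rule algebraically_fibers_if_excess[OF G S T ST _ \<chi> s e])
    show "generate G S \<lhd> G" unfolding gen_S by (rule \<pi>.normal_kernel)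
    show "\<lfloor>f1 (\<pi> a)\<rfloor> = 0" if "a \<in> S" for a
      using generate.incl[OF that, of G] cocycle1_one[OF Q f1(1)] by (simp add: gen_S kernel_def)
    show "\<tau> q \<in> T" "\<lfloor>f1 (\<pi> (\<tau> q))\<rfloor> = 1" using q \<tau>(2) f1(2) by (auto simp: T_def)
  qed
qed

end
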